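(* The sets of patterns $\{112,2121\}$ and $\{121,1122\}$ are $m$-equivalent, that is, $\{112,2121\}\sim\{121,1122\}$.
   Context: A (finite, reduced) multiset is $S=1^{a_1}2^{a_2}\cdots k^{a_k}$ with $k\ge 1$ and all $a_i\ge 1$, meaning that $i$ occurs with multiplicity $a_i$. A multipermutation of $S$ is a word having exactly $a_i$ occurrences of each letter $i\in[k]=\{1,\dots,k\}$ and no other letters. A word $\pi=\pi_1\cdots\pi_n$ contains a pattern (word) $\rho=\rho_1\cdots\rho_\ell$ if there are indices $i(1)<\cdots<i(\ell)$ such that for all $a,b\in[\ell]$: $\pi_{i(a)}<\pi_{i(b)}$ iff $\rho_a<\rho_b$, and $\pi_{i(a)}>\pi_{i(b)}$ iff $\rho_a>\rho_b$; otherwise $\pi$ avoids $\rho$. For a set $P$ of patterns, $\mathrm{av}(S;P)$ is the number of multipermutations of $S$ that avoid every pattern in $P$. Two sets of patterns $P,Q$ are $m$-equivalent, written here $P\sim Q$, if $\mathrm{av}(S;P)=\mathrm{av}(S;Q)$ for every multiset $S$. *)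

theory Defs
  imports "HOL-Combinatorics.Multiset_Permutations"
begin

text \<open>
  Words are lists of natural numbers. A multiset \<open>1^a\<^sub>1 2^a\<^sub>2 \<dots> k^a\<^sub>k\<close> with \<open>k \<ge> 1\<close> and all
  \<open>a\<^sub>i \<ge> 1\<close> is an element of \<^typ>\<open>nat multiset\<close> whose support is exactly \<open>{1..k}\<close>.
\<close>

definition reduced_mset :: "nat multiset \<Rightarrow> bool" where
  "reduced_mset S \<longleftrightarrow> (\<exists>k\<ge>1. set_mset S = {1..k})"

text \<open>Positions in words are counted from 0 rather than from 1.\<close>

definition contains_pattern :: "nat list \<Rightarrow> nat list \<Rightarrow> bool" where
  "contains_pattern \<pi> \<rho> \<longleftrightarrow>
     (\<exists>i :: nat \<Rightarrow> nat.
        strict_mono_on {..<length \<rho>} i \<and>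
        (\<forall>a<length \<rho>. i a < length \<pi>) \<and>
        (\<forall>a<length \<rho>. \<forall>b<length \<rho>.
           (\<pi> ! i a < \<pi> ! i b \<longleftrightarrow> \<rho> ! a < \<rho> ! b) \<and>
           (\<pi> ! i a > \<pi> ! i b \<longleftrightarrow> \<rho> ! a > \<rho> ! b)))"

definition avoids_pattern :: "nat list \<Rightarrow> nat list \<Rightarrow> bool" where
  "avoids_pattern \<pi> \<rho> \<longleftrightarrow> \<not> contains_pattern \<pi> \<rho>"

definition av :: "nat multiset \<Rightarrow> nat list set \<Rightarrow> nat" where
  "av S P = card {\<pi> \<in> permutations_of_multiset S. \<forall>\<rho>\<in>P. avoids_pattern \<pi> \<rho>}"

definition m_equivalent :: "nat list set \<Rightarrow> nat list set \<Rightarrow> bool" where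
  "m_equivalent P Q \<longleftrightarrow> (\<forall>S. reduced_mset S \<longrightarrow> av S P = av S Q)"

end

theory Submission
  imports Defs "HOL-Library.Sublist"
begin

text \<open>
  Words are built by inserting the letters from the largest to the smallest. Let \<open>x\<close>, of
  multiplicity \<open>m + 1\<close>, be smaller than all letters of \<open>w\<close>. The words avoiding 112 and 2121 that
  restrict to \<open>w\<close> are the words \<open>u x v x^m\<close> with \<open>w = u v\<close> where, if \<open>m > 0\<close>, no letter is common
  to \<open>u\<close> and \<open>v\<close>; those avoiding 121 and 1122 are the words \<open>u x^(m+1) v\<close> where, if \<open>m > 0\<close>, \<open>v\<close>
  has no repeated letter. Call the positions \<open>|u|\<close> admissible for \<open>m > 0\<close> the cuts of \<open>w\<close>. In both
  classes, a word with \<open>c\<close> cuts has \<open>c\<close> extensions with \<open>c + 1\<close> cuts and all others with \<open>c\<close> cuts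
  if \<open>m = 0\<close>, and one extension each with \<open>2, \<dots>, c + 1\<close> cuts if \<open>m > 0\<close>. So the generating trees
  of the two classes coincide.
\<close>

section \<open>Pattern containment through subsequences\<close>

lemma subseq_iff_nth:
  "subseq s w \<longleftrightarrow> (\<exists>i. strict_mono_on {..<length s} i \<and> (\<forall>a<length s. i a < length w \<and> w ! i a = s ! a))"
proof
  assume "subseq s w"
  then show "\<exists>i. strict_mono_on {..<length s} i \<and> (\<forall>a<length s. i a < length w \<and> w ! i a = s ! a)"
  proof induction
    case (list_emb_Nil w)
    then show ?case by (simp add: strict_mono_on_def)
  next
    case (list_emb_Cons s w y)
    then obtain i where "strict_mono_on {..<length s} i" "\<forall>a<length s. i a < length w \<and> w ! i a = s ! a"
      by blast
    then show ?case
      by (intro exI[of _ "Suc \<circ> i"]) (simp add: strict_mono_on_def)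
  next
    case (list_emb_Cons2 x y s w)
    then obtain i where i: "strict_mono_on {..<length s} i" "\<forall>a<length s. i a < length w \<and> w ! i a = s ! a"
      by blast
    \<comment> \<open>The matched head goes to position 0 and every later index is shifted by
      one.\<close>
    then have "strict_mono_on {..<length (x # s)} (case_nat 0 (Suc \<circ> i))"
      by (auto simp: strict_mono_on_def split: nat.split)
    with i list_emb_Cons2.hyps show ?case
      by (intro exI[of _ "case_nat 0 (Suc \<circ> i)"]) (auto split: nat.split)
  qed
next
  assume "\<exists>i. strict_mono_on {..<length s} i \<and> (\<forall>a<length s. i a < length w \<and> w ! i a = s ! a)"
  then obtain i where "strict_mono_on {..<length s} i" "\<forall>a<length s. i a < length w \<and> w ! i a = s ! a"
    by blast
  then show "subseq s w"
  proof (induction s arbitrary: w rule: rev_induct)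
    case (snoc y s)
    \<comment> \<open>Cutting \<open>w\<close> at the image of the last index confines the rest of
      the embedding to the prefix before it.\<close>
    let ?k = "i (length s)"
    have k: "?k < length w" "w ! ?k = y" using snoc.prems(2) by auto
    have lt: "i a < ?k" if "a < length s" for a
      using snoc.prems(1) that by (auto simp: strict_mono_on_def)
    have "subseq s (take ?k w)"
    proof (rule snoc.IH)
      show "strict_mono_on {..<length s} i"
        using snoc.prems(1) by (auto simp: strict_mono_on_def)
      show "\<forall>a<length s. i a < length (take ?k w) \<and> take ?k w ! i a = s ! a"
        using snoc.prems(2) lt k by (auto simp: nth_append less_Suc_eq)
    qed
    then have "subseq (s @ [y]) (take ?k w @ y # drop (Suc ?k) w)"
      by (intro list_emb_append_mono) auto
    then show ?case using id_take_nth_drop[OF k(1)] k(2) by simp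
  qed simp
qed

text \<open>Trades the index function for the chosen letters themselves, so that later arguments
  need only list reasoning.\<close>

lemma contains_pattern_iff_subseq:
  "contains_pattern \<pi> \<rho> \<longleftrightarrow>
     (\<exists>s. length s = length \<rho> \<and> subseq s \<pi> \<and>
        (\<forall>a<length \<rho>. \<forall>b<length \<rho>.
           (s ! a < s ! b \<longleftrightarrow> \<rho> ! a < \<rho> ! b) \<and> (s ! a > s ! b \<longleftrightarrow> \<rho> ! a > \<rho> ! b)))"
  (is "_ \<longleftrightarrow> ?R")
proof
  assume "contains_pattern \<pi> \<rho>"
  then obtain i where "strict_mono_on {..<length \<rho>} i" "\<forall>a<length \<rho>. i a < length \<pi>"
    "\<forall>a<length \<rho>. \<forall>b<length \<rho>. (\<pi> ! i a < \<pi> ! i b \<longleftrightarrow> \<rho> ! a < \<rho> ! b) \<and>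
       (\<pi> ! i a > \<pi> ! i b \<longleftrightarrow> \<rho> ! a > \<rho> ! b)"
    unfolding contains_pattern_def by blast
  then show ?R
    by (intro exI[of _ "map (\<lambda>a. \<pi> ! i a) [0..<length \<rho>]"]) (auto simp: subseq_iff_nth)
next
  assume ?R
  then obtain s i where "length s = length \<rho>" "strict_mono_on {..<length s} i"
    "\<forall>a<length s. i a < length \<pi> \<and> \<pi> ! i a = s ! a"
    "\<forall>a<length \<rho>. \<forall>b<length \<rho>.
       (s ! a < s ! b \<longleftrightarrow> \<rho> ! a < \<rho> ! b) \<and> (s ! a > s ! b \<longleftrightarrow> \<rho> ! a > \<rho> ! b)"
    unfolding subseq_iff_nth by blast
  then show "contains_pattern \<pi> \<rho>"
    unfolding contains_pattern_def by (intro exI[of _ i]) auto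
qed

lemma ex_length_3: "(\<exists>s. length s = Suc (Suc (Suc 0)) \<and> P s) \<longleftrightarrow> (\<exists>a b c. P [a, b, c])"
  by (auto simp: length_Suc_conv; blast)

lemma ex_length_4: "(\<exists>s. length s = Suc (Suc (Suc (Suc 0))) \<and> P s) \<longleftrightarrow> (\<exists>a b c d. P [a, b, c, d])"
  by (auto simp: length_Suc_conv; blast)

text \<open>The order conditions are expanded letter by letter; equal pattern letters force equal
  letters because neither may be below the other.\<close>

lemma contains_pattern_112: "contains_pattern \<pi> [1, 1, 2] \<longleftrightarrow> (\<exists>a b. a < b \<and> subseq [a, a, b] \<pi>)"
  by (simp add: contains_pattern_iff_subseq ex_length_3 All_less_Suc2 antisym_conv3 cong: conj_cong)
    (auto simp: antisym_conv3)

lemma contains_pattern_121: "contains_pattern \<pi> [1, 2, 1] \<longleftrightarrow> (\<exists>a b. a < b \<and> subseq [a, b, a] \<pi>)"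
  by (simp add: contains_pattern_iff_subseq ex_length_3 All_less_Suc2 antisym_conv3 cong: conj_cong)
    (auto simp: antisym_conv3)

lemma contains_pattern_2121:
  "contains_pattern \<pi> [2, 1, 2, 1] \<longleftrightarrow> (\<exists>a b. a < b \<and> subseq [b, a, b, a] \<pi>)"
  by (simp add: contains_pattern_iff_subseq ex_length_4 All_less_Suc2 antisym_conv3 cong: conj_cong)
    (metis order.asym)

lemma contains_pattern_1122:
  "contains_pattern \<pi> [1, 1, 2, 2] \<longleftrightarrow> (\<exists>a b. a < b \<and> subseq [a, a, b, b] \<pi>)"
  by (simp add: contains_pattern_iff_subseq ex_length_4 All_less_Suc2 antisym_conv3 cong: conj_cong)
    (auto simp: antisym_conv3)

section \<open>The two avoidance classes and their cuts\<close>

definition av_112_2121 :: "'a::linorder list \<Rightarrow> bool" where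
  "av_112_2121 w \<longleftrightarrow> (\<forall>a b. a < b \<longrightarrow> \<not> subseq [a, a, b] w \<and> \<not> subseq [b, a, b, a] w)"

definition av_121_1122 :: "'a::linorder list \<Rightarrow> bool" where
  "av_121_1122 w \<longleftrightarrow> (\<forall>a b. a < b \<longrightarrow> \<not> subseq [a, b, a] w \<and> \<not> subseq [a, a, b, b] w)"

text \<open>The cuts for \<open>av_112_2121\<close>. Positions run from 0 to \<open>length w\<close>
  inclusive, and both ends always qualify.\<close>

definition disjoint_cuts :: "'a list \<Rightarrow> nat set" where
  "disjoint_cuts w = {p. p \<le> length w \<and> set (take p w) \<inter> set (drop p w) = {}}"

text \<open>The cuts for \<open>av_121_1122\<close>. They form a final segment of the positions and
  always contain \<open>length w\<close>.\<close>

definition distinct_cuts :: "'a list \<Rightarrow> nat set" where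
  "distinct_cuts w = {p. p \<le> length w \<and> distinct (drop p w)}"

section \<open>Auxiliary facts on subsequences\<close>

lemma subseq_removeAllD: "subseq s (removeAll x w) \<Longrightarrow> subseq s w"
  by (metis removeAll_filter_not_eq subseq_filter_left subseq_order.trans)

lemma subseq_removeAll_iff:
  assumes "x \<notin> set s"
  shows "subseq s (removeAll x w) \<longleftrightarrow> subseq s w"
proof
  show "subseq s (removeAll x w)" if "subseq s w"
    using subseq_filter[OF that, of "\<lambda>y. x \<noteq> y"] assms
    by (metis removeAll_filter_not_eq removeAll_id)
qed (rule subseq_removeAllD)

text \<open>The first letter cannot be matched inside \<open>u\<close>, and everything else is
  matched after it.\<close>

lemma subseq_Cons_append_iff:
  "x \<notin> set u \<Longrightarrow> subseq (x # s) (u @ v) \<longleftrightarrow> subseq (x # s) v"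
  by (induction u) auto

lemma set_mono_subseq: "subseq s w \<Longrightarrow> set s \<subseteq> set w"
  by (induction rule: list_emb.induct) auto

text \<open>Translates the final \<open>22\<close> of the pattern 1122 into the condition behind
  \<open>distinct_cuts\<close>.\<close>

lemma subseq_pair_iff: "(\<exists>b. subseq [b, b] w) \<longleftrightarrow> \<not> distinct w"
proof (induction w)
  case (Cons a w)
  have "(\<exists>b. subseq [b, b] (a # w)) \<longleftrightarrow> subseq [a] w \<or> (\<exists>b. subseq [b, b] w)"
    by (metis subseq_Cons' subseq_Cons2_iff)
  then have "(\<exists>b. subseq [b, b] (a # w)) \<longleftrightarrow> a \<in> set w \<or> (\<exists>b. subseq [b, b] w)"
    by (simp only: subseq_singleton_left)
  with Cons show ?case by simp
qed simp

section \<open>Avoidance when the smallest letter is inserted\<close>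

text \<open>An occurrence without \<open>x\<close> survives the deletion of \<open>x\<close>; in any
  other, minimality makes \<open>x\<close> the smaller of the two letters.\<close>

lemma av_112_2121_removeAll:
  assumes "\<forall>y\<in>set w. x \<le> y"
  shows "av_112_2121 w \<longleftrightarrow> av_112_2121 (removeAll x w) \<and>
     (\<forall>b>x. \<not> subseq [x, x, b] w \<and> \<not> subseq [b, x, b, x] w)" (is "?L \<longleftrightarrow> ?R")
proof
  show "?L \<Longrightarrow> ?R"
    unfolding av_112_2121_def
    by (blast dest: subseq_removeAllD)
  assume ?R
  show ?L
    unfolding av_112_2121_def
  proof (intro allI impI)
    fix a b :: 'a assume "a < b"
    show "\<not> subseq [a, a, b] w \<and> \<not> subseq [b, a, b, a] w"
    proof (cases "x < a")
      case True
      with \<open>a < b\<close> have "x \<noteq> a" "x \<noteq> b" by auto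
      with True \<open>a < b\<close> \<open>?R\<close> show ?thesis
        unfolding av_112_2121_def using subseq_removeAll_iff[of x "[a, a, b]" w]
          subseq_removeAll_iff[of x "[b, a, b, a]" w] by auto
    next
      case False
      with assms have "a = x \<or> a \<notin> set w" by (metis order.order_iff_strict)
      with \<open>a < b\<close> \<open>?R\<close> show ?thesis
        using set_mono_subseq[of "[a, a, b]" w] set_mono_subseq[of "[b, a, b, a]" w] by auto
    qed
  qed
qed

lemma av_121_1122_removeAll:
  assumes "\<forall>y\<in>set w. x \<le> y"
  shows "av_121_1122 w \<longleftrightarrow> av_121_1122 (removeAll x w) \<and>
     (\<forall>b>x. \<not> subseq [x, b, x] w \<and> \<not> subseq [x, x, b, b] w)" (is "?L \<longleftrightarrow> ?R")
proof
  show "?L \<Longrightarrow> ?R"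
    unfolding av_121_1122_def
    by (blast dest: subseq_removeAllD)
  assume ?R
  show ?L
    unfolding av_121_1122_def
  proof (intro allI impI)
    fix a b :: 'a assume "a < b"
    show "\<not> subseq [a, b, a] w \<and> \<not> subseq [a, a, b, b] w"
    proof (cases "x < a")
      case True
      with \<open>a < b\<close> have "x \<noteq> a" "x \<noteq> b" by auto
      with True \<open>a < b\<close> \<open>?R\<close> show ?thesis
        unfolding av_121_1122_def using subseq_removeAll_iff[of x "[a, b, a]" w]
          subseq_removeAll_iff[of x "[a, a, b, b]" w] by auto
    next
      case False
      with assms have "a = x \<or> a \<notin> set w" by (metis order.order_iff_strict)
      with \<open>a < b\<close> \<open>?R\<close> show ?thesis
        using set_mono_subseq[of "[a, b, a]" w] set_mono_subseq[of "[a, a, b, b]" w] by auto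
    qed
  qed
qed

lemma removeAll_replicate [simp]: "removeAll x (replicate m x) = []"
  by (induction m) auto

text \<open>Nothing larger follows a second \<open>x\<close>, so 112 cannot use \<open>x\<close>. An
  occurrence of 2121 with \<open>x\<close> as 1 needs a final \<open>x\<close> and a letter
  occurring on both sides of the first \<open>x\<close>.\<close>

lemma av_112_2121_insert:
  assumes "\<forall>y\<in>set u \<union> set v. x < y"
  shows "av_112_2121 (u @ x # v @ replicate m x) \<longleftrightarrow>
     av_112_2121 (u @ v) \<and> (m = 0 \<or> set u \<inter> set v = {})"
proof -
  let ?w = "u @ x # v @ replicate m x"
  have x: "x \<notin> set u" "x \<notin> set v" using assms by auto
  have le: "\<forall>y\<in>set ?w. x \<le> y" using assms by (auto intro: less_imp_le)
  have "\<not> subseq [x, x, b] ?w" if "x < b" for b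
    using x that by (auto simp: subseq_Cons_append_iff dest!: set_mono_subseq)
  moreover have "(\<exists>b>x. subseq [b, x, b, x] ?w) \<longleftrightarrow> m > 0 \<and> set u \<inter> set v \<noteq> {}"
  proof
    assume "\<exists>b>x. subseq [b, x, b, x] ?w"
    then obtain b where b: "b > x" "subseq [b, x, b, x] ?w" by blast
    have "b \<in> set u"
    proof (rule ccontr)
      assume "b \<notin> set u"
      with b have "subseq [b, x, b, x] (v @ replicate m x)" by (simp add: subseq_Cons_append_iff)
      \<comment> \<open>With the first \<open>b\<close> beyond the first \<open>x\<close>, the next
        \<open>x\<close> must come from the final block, which has no room for another
        \<open>b\<close>.\<close>
      then have "subseq [x, b, x] (v @ replicate m x)" by (rule subseq_Cons')
      then have "subseq [x, b, x] (replicate m x)" using x by (simp add: subseq_Cons_append_iff)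
      with b(1) show False by (auto dest!: set_mono_subseq)
    qed
    have "subseq [x, b, x] ?w" using b(2) by (rule subseq_Cons')
    then have "subseq [b, x] (v @ replicate m x)" using x by (simp add: subseq_Cons_append_iff)
    then have "b \<in> set v" "m > 0" 
      using b(1) x by (auto dest!: set_mono_subseq split: if_splits)
    with \<open>b \<in> set u\<close> show "m > 0 \<and> set u \<inter> set v \<noteq> {}" by auto
  next
    assume *: "m > 0 \<and> set u \<inter> set v \<noteq> {}"
    then obtain b where b: "b \<in> set u" "b \<in> set v" by auto
    with * have "subseq ([b] @ [x] @ [b] @ [x]) (u @ [x] @ v @ replicate m x)"
      by (intro list_emb_append_mono) (auto simp: subseq_singleton_left)
    with b assms show "\<exists>b>x. subseq [b, x, b, x] ?w" by auto
  qed
  ultimately show ?thesis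
    using av_112_2121_removeAll[OF le] x by auto
qed

text \<open>The copies of \<open>x\<close> are contiguous, which excludes 121 with \<open>x\<close>
  as 1. An occurrence of 1122 with \<open>x\<close> as 1 needs two copies of \<open>x\<close> and a
  letter repeated in \<open>v\<close>.\<close>

lemma av_121_1122_insert:
  assumes "\<forall>y\<in>set u \<union> set v. x < y"
  shows "av_121_1122 (u @ x # replicate m x @ v) \<longleftrightarrow>
     av_121_1122 (u @ v) \<and> (m = 0 \<or> distinct v)"
proof -
  let ?w = "u @ x # replicate m x @ v"
  have x: "x \<notin> set u" "x \<notin> set v" using assms by auto
  have le: "\<forall>y\<in>set ?w. x \<le> y" using assms by (auto intro: less_imp_le)
  have "\<not> subseq [x, b, x] ?w" if "x < b" for b
  proof -
    from that have "b \<notin> set (replicate m x)" by auto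
    with x show ?thesis by (auto simp: subseq_Cons_append_iff dest!: set_mono_subseq)
  qed
  moreover have "(\<exists>b>x. subseq [x, x, b, b] ?w) \<longleftrightarrow> m > 0 \<and> \<not> distinct v"
  proof
    assume "\<exists>b>x. subseq [x, x, b, b] ?w"
    then obtain b where b: "b > x" "subseq [x, x, b, b] ?w" by blast
    then have *: "subseq [x, b, b] (replicate m x @ v)"
      using x by (simp add: subseq_Cons_append_iff)
    then have "m > 0" using x b(1) by (cases m) (auto dest!: set_mono_subseq)
    moreover have "subseq [b, b] v"
    proof -
      have "b \<notin> set (replicate m x)" using b(1) by auto
      then show ?thesis by (rule iffD1[OF subseq_Cons_append_iff, OF _ subseq_Cons'[OF *]])
    qed
    ultimately show "m > 0 \<and> \<not> distinct v" using subseq_pair_iff[of v] by auto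
  next
    assume *: "m > 0 \<and> \<not> distinct v"
    then obtain b where b: "subseq [b, b] v" using subseq_pair_iff[of v] by auto
    with * have "subseq ([] @ [x] @ [x] @ [b, b]) (u @ [x] @ replicate m x @ v)"
      by (intro list_emb_append_mono) (auto simp: subseq_singleton_left)
    then have "subseq [x, x, b, b] ?w" by simp
    moreover from b assms have "x < b" by (auto dest: set_mono_subseq)
    ultimately show "\<exists>b>x. subseq [x, x, b, b] ?w" by blast
  qed
  ultimately show ?thesis
    using av_121_1122_removeAll[OF le] x by auto
qed

text \<open>\<open>v\<close> is what lies between the first two copies of \<open>x\<close>; any
  larger letter after the second copy would complete a 112. \<open>m\<close> counts the copies
  beyond the first.\<close>

lemma av_112_2121_decompose:
  assumes "av_112_2121 w" "x \<in> set w" "\<forall>y\<in>set w. x \<le> y"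
  obtains u v m where "w = u @ x # v @ replicate m x" "x \<notin> set u" "x \<notin> set v"
proof -
  obtain u r where w: "w = u @ x # r" and u: "x \<notin> set u"
    using split_list_first[OF assms(2)] by blast
  show thesis
  proof (cases "x \<in> set r")
    case False
    with w u that[of u r 0] show ?thesis by simp
  next
    case True
    then obtain v t where r: "r = v @ x # t" and v: "x \<notin> set v"
      using split_list_first by metis
    have "y = x" if "y \<in> set t" for y
    proof (rule ccontr)
      assume "y \<noteq> x"
      with that assms(3) w r have "x < y" by (auto simp: order.strict_iff_order)
      moreover have "subseq [x, x, y] w"
        unfolding w r using u v that by (simp add: subseq_Cons_append_iff subseq_singleton_left)
      ultimately show False using assms(1) by (auto simp: av_112_2121_def)
    qed
    then have "t = replicate (length t) x" by (simp add: replicate_eqI)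
    then have "w = u @ x # v @ replicate (Suc (length t)) x" using w r by simp
    then show ?thesis using that u v by blast
  qed
qed

text \<open>The word is split at the first and the last \<open>x\<close>; a larger letter between
  them would form a 121.\<close>

lemma av_121_1122_decompose:
  assumes "av_121_1122 w" "x \<in> set w" "\<forall>y\<in>set w. x \<le> y"
  obtains u v m where "w = u @ x # replicate m x @ v" "x \<notin> set u" "x \<notin> set v"
proof -
  obtain u r where w: "w = u @ x # r" and u: "x \<notin> set u"
    using split_list_first[OF assms(2)] by blast
  show thesis
  proof (cases "x \<in> set r")
    case False
    with w u that[of u 0 r] show ?thesis by simp
  next
    case True
    then obtain t v where r: "r = t @ x # v" and v: "x \<notin> set v"
      using split_list_last by metis
    have "y = x" if "y \<in> set t" for y
    proof (rule ccontr)
      assume "y \<noteq> x"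
      with that assms(3) w r have "x < y" by (auto simp: order.strict_iff_order)
      moreover have "subseq ([] @ [x] @ [y] @ [x]) (u @ [x] @ t @ (x # v))"
        using that by (intro list_emb_append_mono) (auto simp: subseq_singleton_left)
      ultimately show False using assms(1) w r by (auto simp: av_121_1122_def)
    qed
    then have "t @ [x] = replicate (Suc (length t)) x" 
      by (metis replicate_eqI replicate_append_same replicate_Suc)
    then have "w = u @ x # replicate (Suc (length t)) x @ v" using w r by simp
    then show ?thesis using that u v by blast
  qed
qed

section \<open>Cuts after an insertion\<close>

text \<open>A single new letter never spoils disjointness: cuts before it stay, cuts after it shift
  by one. A cut at \<open>length u\<close> yields two, one on each side of \<open>x\<close>, hence
  both inequalities are weak.\<close>

lemma disjoint_cuts_insert:
  assumes "x \<notin> set u" "x \<notin> set v"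
  shows "disjoint_cuts (u @ x # v) =
     {p \<in> disjoint_cuts (u @ v). p \<le> length u} \<union> Suc ` {p \<in> disjoint_cuts (u @ v). length u \<le> p}"
    (is "?L = ?R")
proof (intro set_eqI)
  fix q
  consider (lo) "q \<le> length u" | (hi) p where "q = Suc p" "length u \<le> p"
    by (metis Suc_le_D not_less_eq_eq Suc_le_mono)
  then show "q \<in> ?L \<longleftrightarrow> q \<in> ?R"
  proof cases
    case lo
    with assms show ?thesis by (auto simp: disjoint_cuts_def dest: in_set_takeD)
  next
    case hi
    with assms show ?thesis
      by (auto simp: disjoint_cuts_def Suc_diff_le image_iff dest: in_set_dropD)
  qed
qed

text \<open>A single new letter creates no repetition, so cuts behave exactly as for
  \<open>disjoint_cuts\<close>.\<close>

lemma distinct_cuts_insert: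
  assumes "x \<notin> set u" "x \<notin> set v"
  shows "distinct_cuts (u @ x # v) =
     {p \<in> distinct_cuts (u @ v). p \<le> length u} \<union> Suc ` {p \<in> distinct_cuts (u @ v). length u \<le> p}"
    (is "?L = ?R")
proof (intro set_eqI)
  fix q
  consider (lo) "q \<le> length u" | (hi) p where "q = Suc p" "length u \<le> p"
    by (metis Suc_le_D not_less_eq_eq Suc_le_mono)
  then show "q \<in> ?L \<longleftrightarrow> q \<in> ?R"
  proof cases
    case lo
    with assms show ?thesis by (auto simp: distinct_cuts_def dest: in_set_dropD)
  next
    case hi
    with assms show ?thesis
      by (auto simp: distinct_cuts_def Suc_diff_le image_iff)
  qed
qed

text \<open>A position between the first and the last \<open>x\<close> separates equal letters. Only
  cuts up to \<open>length u\<close> survive, together with the end of the word.\<close>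

lemma disjoint_cuts_insert_replicate:
  assumes "x \<notin> set u" "x \<notin> set v" "m > 0"
  shows "disjoint_cuts (u @ x # v @ replicate m x) =
     insert (Suc (length u + length v + m)) {p \<in> disjoint_cuts (u @ v). p \<le> length u}"
    (is "?L = ?R")
proof (intro set_eqI)
  fix q
  consider (lo) "q \<le> length u" | (hi) p where "q = Suc p" "length u \<le> p"
    by (metis Suc_le_D not_less_eq_eq Suc_le_mono)
  then show "q \<in> ?L \<longleftrightarrow> q \<in> ?R"
  proof cases
    case lo
    with assms show ?thesis by (auto simp: disjoint_cuts_def dest: in_set_takeD)
  next
    case hi
    with assms show ?thesis
      \<comment> \<open>The case distinction asks whether \<open>Suc p\<close> lies before the end,
        that is, whether an \<open>x\<close> remains on its right.\<close>
      by (cases "p < length u + length v + m") (auto simp: disjoint_cuts_def Suc_diff_le)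
  qed
qed

text \<open>A suffix holding two copies of \<open>x\<close> is not distinct. The suffix starting at
  the last \<open>x\<close> gives the new cut, and cuts behind the block shift by its length
  \<open>Suc m\<close>.\<close>

lemma distinct_cuts_insert_replicate:
  assumes "x \<notin> set u" "x \<notin> set v" "m > 0" "distinct v"
  shows "distinct_cuts (u @ x # replicate m x @ v) =
     insert (length u + m) ((\<lambda>p. Suc (p + m)) ` {p \<in> distinct_cuts (u @ v). length u \<le> p})"
    (is "?L = ?R")
proof (intro set_eqI)
  fix q
  consider (lo) "q < length u + m" | (mid) "q = length u + m"
    | (hi) p where "q = Suc (p + m)" "length u \<le> p"
    by (metis Suc_le_D less_Suc_eq_le linorder_neqE_nat not_less_eq nat_le_iff_add add.commute
      add.left_commute add_Suc_right)
  then show "q \<in> ?L \<longleftrightarrow> q \<in> ?R"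
  proof cases
    case lo
    \<comment> \<open>Regrouping isolates the last \<open>x\<close>; the remaining suffix then
      contains an earlier \<open>x\<close> as well.\<close>
    have "u @ x # replicate m x @ v = (u @ replicate m x) @ x # v"
      by (simp add: replicate_app_Cons_same)
    moreover have "drop q ((u @ replicate m x) @ x # v) = drop q (u @ replicate m x) @ x # v"
      using lo by (subst drop_append) simp
    moreover have "x \<in> set (drop q (u @ replicate m x))"
      using lo assms by (cases "q \<le> length u") auto
    ultimately have "\<not> distinct (drop q (u @ x # replicate m x @ v))"
      by (metis distinct_append disjoint_iff list.set_intros(1))
    then have "q \<notin> ?L" unfolding distinct_cuts_def by blast
    moreover have "q \<notin> ?R" using lo by auto
    ultimately show ?thesis by blast
  next
    case mid
    have "u @ x # replicate m x @ v = (u @ replicate m x) @ x # v"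
      by (simp add: replicate_app_Cons_same)
    moreover have "drop q ((u @ replicate m x) @ x # v) = x # v"
      unfolding mid by (subst drop_append) simp
    ultimately have "distinct (drop q (u @ x # replicate m x @ v))"
      using assms by (metis distinct.simps(2))
    moreover have "q \<le> length (u @ x # replicate m x @ v)" using mid by simp
    ultimately have "q \<in> ?L" unfolding distinct_cuts_def by blast
    with mid show ?thesis by blast
  next
    case hi
    then have "q - length u = Suc ((p - length u) + m)" by simp
    with hi assms show ?thesis
      by (auto simp: distinct_cuts_def image_iff)
  qed
qed

section \<open>Sums over ranks and cardinalities of shifted sets\<close>

text \<open>The summand sees only the rank of \<open>p\<close> in \<open>D\<close>, and each rank
  from 1 to \<open>card D\<close> is taken once. Adding a new maximum leaves the other ranks
  unchanged.\<close>

lemma sum_card_le: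
  fixes D :: "nat set" and h :: "nat \<Rightarrow> nat"
  assumes "finite D"
  shows "(\<Sum>p\<in>D. h (card {q \<in> D. q \<le> p})) = (\<Sum>j=1..card D. h j)"
  using assms
proof (induction D rule: finite_linorder_max_induct)
  case (insert b D)
  have "{q \<in> insert b D. q \<le> p} = {q \<in> D. q \<le> p}" if "p \<in> D" for p
    using insert.hyps that by force
  moreover have "{q \<in> insert b D. q \<le> b} = insert b D"
    using insert.hyps by force
  moreover have "b \<notin> D" using insert.hyps by auto
  ultimately show ?case using insert by simp
qed simp

text \<open>Here ranks are counted from the top, so the induction adds a new minimum.\<close>

lemma sum_card_ge:
  fixes D :: "nat set" and h :: "nat \<Rightarrow> nat"
  assumes "finite D"
  shows "(\<Sum>p\<in>D. h (card {q \<in> D. p \<le> q})) = (\<Sum>j=1..card D. h j)"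
  using assms
proof (induction D rule: finite_linorder_min_induct)
  case (insert b D)
  have "{q \<in> insert b D. p \<le> q} = {q \<in> D. p \<le> q}" if "p \<in> D" for p
    using insert.hyps that by force
  moreover have "{q \<in> insert b D. b \<le> q} = insert b D"
    using insert.hyps by force
  moreover have "b \<notin> D" using insert.hyps by auto
  ultimately show ?case using insert by simp
qed simp

text \<open>The two parts of \<open>D\<close> overlap at most in \<open>n\<close>, and the shift
  makes them disjoint, so \<open>n\<close> is counted twice.\<close>

lemma card_split_at:
  fixes D :: "nat set"
  assumes "finite D"
  shows "card ({p \<in> D. p \<le> n} \<union> Suc ` {p \<in> D. n \<le> p}) = card D + (if n \<in> D then 1 else 0)"
proof -
  have "card ({p \<in> D. p \<le> n} \<union> Suc ` {p \<in> D. n \<le> p}) = card {p \<in> D. p \<le> n} + card {p \<in> D. n \<le> p}"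
    using assms by (subst card_Un_disjoint) (auto simp: card_image)
  also have "\<dots> = card ({p \<in> D. p \<le> n} \<union> {p \<in> D. n \<le> p}) + card ({p \<in> D. p \<le> n} \<inter> {p \<in> D. n \<le> p})"
    using assms by (intro card_Un_Int) auto
  also have "{p \<in> D. p \<le> n} \<union> {p \<in> D. n \<le> p} = D" by auto
  also have "{p \<in> D. p \<le> n} \<inter> {p \<in> D. n \<le> p} = (if n \<in> D then {n} else {})" by auto
  finally show ?thesis by simp
qed

lemma disjoint_cuts_le: "disjoint_cuts w \<subseteq> {..length w}"
  by (auto simp: disjoint_cuts_def)

lemma distinct_cuts_le: "distinct_cuts w \<subseteq> {..length w}"
  by (auto simp: distinct_cuts_def)

lemma finite_disjoint_cuts [simp]: "finite (disjoint_cuts w)"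
  using disjoint_cuts_le by (rule finite_subset) simp

lemma finite_distinct_cuts [simp]: "finite (distinct_cuts w)"
  using distinct_cuts_le by (rule finite_subset) simp

section \<open>One level of the generating trees\<close>

text \<open>The bijection shared by both classes: an extended word corresponds to a smaller word and
  an insertion position. \<open>C\<close> stands for the cuts, which restrict the position only when
  \<open>x\<close> is repeated.\<close>

lemma sum_over_insertions:
  fixes P :: "'a::linorder list \<Rightarrow> bool" and f :: "'a list \<Rightarrow> nat"
  assumes M: "\<forall>y\<in>#M. x < y"
    and mset_ins: "\<And>u v. mset (ins u v) = mset (u @ v) + replicate_mset (Suc m) x"
    and remove_ins: "\<And>u v. removeAll x (ins u v) = removeAll x (u @ v)"
    and take_ins: "\<And>u v. x \<notin> set u \<Longrightarrow> takeWhile (\<lambda>y. y \<noteq> x) (ins u v) = u"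
    and P_ins: "\<And>u v. \<forall>y\<in>set u \<union> set v. x < y \<Longrightarrow>
      P (ins u v) \<longleftrightarrow> P (u @ v) \<and> (m = 0 \<or> length u \<in> C (u @ v))"
    and decompose: "\<And>w. P w \<Longrightarrow> x \<in> set w \<Longrightarrow> \<forall>y\<in>set w. x \<le> y \<Longrightarrow>
      \<exists>u v k. mset w = mset (u @ v) + replicate_mset (Suc k) x \<and> x \<notin> set u \<and> x \<notin> set v \<and>
        (k = m \<longrightarrow> w = ins u v)"
    and C_le: "\<And>w. C w \<subseteq> {..length w}"
  shows "(\<Sum>w | w \<in> permutations_of_multiset (M + replicate_mset (Suc m) x) \<and> P w. f w) =
    (\<Sum>w | w \<in> permutations_of_multiset M \<and> P w.
       \<Sum>p\<in>(if m = 0 then {..size M} else C w). f (ins (take p w) (drop p w)))"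
proof -
  let ?A = "{w. w \<in> permutations_of_multiset M \<and> P w}"
  let ?Q = "\<lambda>w. if m = 0 then {..size M} else C w"
  let ?B = "{w. w \<in> permutations_of_multiset (M + replicate_mset (Suc m) x) \<and> P w}"
  have fin: "finite (?Q w)" for w
    using finite_subset[OF C_le[of w]] by auto
  have Q: "mset w = M" "\<forall>y\<in>set w. x < y" "P w" "p \<le> length w" "m = 0 \<or> p \<in> C w"
    if "w \<in> ?A" "p \<in> ?Q w" for w p
  proof -
    show w: "mset w = M" using that by (auto dest: permutations_of_multisetD)
    with M show "\<forall>y\<in>set w. x < y" by auto
    show "P w" using that by auto
    show "p \<le> length w"
      using that C_le[of w] w by (auto split: if_splits simp flip: size_mset)
    show "m = 0 \<or> p \<in> C w" using that by (auto split: if_splits)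
  qed
  have B: "\<exists>u v. w = ins u v \<and> mset (u @ v) = M \<and> (\<forall>y\<in>set u \<union> set v. x < y) \<and> P w" if "w \<in> ?B" for w
  proof -
    from that have w: "mset w = M + replicate_mset (Suc m) x" "P w"
      by (auto dest: permutations_of_multisetD)
    from w(1) have "set w = set_mset (M + replicate_mset (Suc m) x)" by (metis set_mset_mset)
    with M have "x \<in> set w" "\<forall>y\<in>set w. x \<le> y" by auto
    with decompose[OF w(2)] obtain u v k where
      uv: "mset w = mset (u @ v) + replicate_mset (Suc k) x" "x \<notin> set u" "x \<notin> set v"
        "k = m \<longrightarrow> w = ins u v" by blast
    \<comment> \<open>Counting \<open>x\<close> in both descriptions of \<open>mset w\<close> forces
      the block length \<open>k\<close> to be \<open>m\<close>.\<close>
    have "count (mset (u @ v)) x = 0" using uv(2,3) by (simp add: count_eq_zero_iff)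
    moreover have "count M x = 0" using M by (auto simp: count_eq_zero_iff)
    moreover have "count (mset w) x = count M x + Suc m" using w(1) by simp
    moreover have "count (mset w) x = count (mset (u @ v)) x + Suc k" using uv(1) by simp
    ultimately have "k = m" by linarith
    with uv w have *: "mset (u @ v) = M" "w = ins u v" by auto
    from *(1) have "set u \<union> set v = set_mset M" by auto
    with M have "\<forall>y\<in>set u \<union> set v. x < y" by simp
    with * w(2) show ?thesis by blast
  qed
  have "(\<Sum>w\<in>?A. \<Sum>p\<in>?Q w. f (ins (take p w) (drop p w))) =
      (\<Sum>(w, p)\<in>Sigma ?A ?Q. f (ins (take p w) (drop p w)))"
    by (rule sum.Sigma) (use fin in auto)
  also have "\<dots> = (\<Sum>w\<in>?B. f w)"
  \<comment> \<open>The inverse deletes \<open>x\<close> and recovers the position as the length of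
    the prefix before the first \<open>x\<close>.\<close>
  proof (rule sum.reindex_bij_witness[where
        i = "\<lambda>w. (removeAll x w, length (takeWhile (\<lambda>y. y \<noteq> x) w))" and
        j = "\<lambda>(w, p). ins (take p w) (drop p w)"])
    fix z assume "z \<in> Sigma ?A ?Q"
    then obtain w p where z: "z = (w, p)" "w \<in> ?A" "p \<in> ?Q w" by blast
    note q = Q[OF z(2,3)]
    have sub: "\<forall>y\<in>set (take p w) \<union> set (drop p w). x < y"
      using q(2) by (auto dest: in_set_takeD in_set_dropD)
    then have "x \<notin> set (take p w)" by auto
    moreover have "x \<notin> set w" using q(2) by auto
    ultimately show "(\<lambda>w. (removeAll x w, length (takeWhile (\<lambda>y. y \<noteq> x) w)))
        ((\<lambda>(w, p). ins (take p w) (drop p w)) z) = z"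
      using q(4) z(1) by (simp add: take_ins remove_ins flip: removeAll_append)
    show "(\<lambda>(w, p). ins (take p w) (drop p w)) z \<in> ?B"
      using P_ins[OF sub] q z(1) mset_ins[of "take p w" "drop p w"]
      by (auto intro!: permutations_of_multisetI simp flip: mset_append)
    show "f ((\<lambda>(w, p). ins (take p w) (drop p w)) z) = (case z of (w, p) \<Rightarrow> f (ins (take p w) (drop p w)))"
      using z by simp
  next
    fix w assume "w \<in> ?B"
    from B[OF this] obtain u v where
      uv: "w = ins u v" "mset (u @ v) = M" "\<forall>y\<in>set u \<union> set v. x < y" "P w" by blast
    from uv(3) have x: "x \<notin> set u" "x \<notin> set v" by auto
    then have j: "(removeAll x w, length (takeWhile (\<lambda>y. y \<noteq> x) w)) = (u @ v, length u)"
      by (simp add: uv(1) take_ins remove_ins)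
    show "(\<lambda>(w, p). ins (take p w) (drop p w)) (removeAll x w, length (takeWhile (\<lambda>y. y \<noteq> x) w)) = w"
      unfolding j by (simp add: uv(1))
    have "length (u @ v) = size M" using uv(2) by (metis size_mset)
    with P_ins[OF uv(3)] uv(1,2,4)
    show "(removeAll x w, length (takeWhile (\<lambda>y. y \<noteq> x) w)) \<in> Sigma ?A ?Q"
      unfolding j by (auto intro!: permutations_of_multisetI)
  qed
  finally show ?thesis by simp
qed

text \<open>Total weight of the children of a word of length \<open>n\<close> with \<open>c\<close>
  cuts, the new letter having multiplicity \<open>Suc m\<close>. For \<open>m = 0\<close> there are
  \<open>Suc n\<close> positions, and exactly the \<open>c\<close> cuts among them raise the number
  of cuts.\<close>

definition insertion_sum :: "nat \<Rightarrow> nat \<Rightarrow> (nat \<Rightarrow> nat) \<Rightarrow> nat \<Rightarrow> nat" where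
  "insertion_sum m n h c =
     (if m = 0 then c * h (Suc c) + (Suc n - c) * h c else (\<Sum>j=1..c. h (Suc j)))"

lemma sum_card_plus_indicator:
  fixes h :: "nat \<Rightarrow> nat"
  assumes "D \<subseteq> {..n}"
  shows "(\<Sum>p\<le>n. h (card D + (if p \<in> D then 1 else 0))) = insertion_sum 0 n h (card D)"
proof -
  have "(\<Sum>p\<le>n. h (card D + (if p \<in> D then 1 else 0))) =
      (\<Sum>p\<le>n. if p \<in> D then h (Suc (card D)) else h (card D))"
    by (intro sum.cong) auto
  also have "\<dots> = card ({..n} \<inter> D) * h (Suc (card D)) + card ({..n} \<inter> - D) * h (card D)"
    by (simp add: sum.If_cases)
  also have "{..n} \<inter> D = D" using assms by blast
  also have "card ({..n} \<inter> - D) = Suc n - card D"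
    using assms by (simp add: Diff_eq[symmetric] card_Diff_subset finite_subset)
  finally show ?thesis by (simp add: insertion_sum_def)
qed

text \<open>The numbers of cuts of the children depend only on that of the parent. For
  \<open>m > 0\<close>, inserting at the cut \<open>p\<close> keeps the cuts up to \<open>p\<close>
  and adds the end, giving one more than the rank of \<open>p\<close>.\<close>

lemma sum_av_112_2121:
  fixes x :: "'a::linorder"
  assumes M: "\<forall>y\<in>#M. x < y"
  shows "(\<Sum>w | w \<in> permutations_of_multiset (M + replicate_mset (Suc m) x) \<and> av_112_2121 w.
      h (card (disjoint_cuts w))) =
    (\<Sum>w | w \<in> permutations_of_multiset M \<and> av_112_2121 w.
      insertion_sum m (size M) h (card (disjoint_cuts w)))"
proof -
  let ?ins = "\<lambda>u v. u @ x # v @ replicate m x"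
  have "(\<Sum>w | w \<in> permutations_of_multiset (M + replicate_mset (Suc m) x) \<and> av_112_2121 w.
      h (card (disjoint_cuts w))) =
    (\<Sum>w | w \<in> permutations_of_multiset M \<and> av_112_2121 w.
       \<Sum>p\<in>(if m = 0 then {..size M} else disjoint_cuts w).
         h (card (disjoint_cuts (?ins (take p w) (drop p w)))))"
  proof (rule sum_over_insertions[OF M])
    fix w :: "'a list" assume "av_112_2121 w" "x \<in> set w" "\<forall>y\<in>set w. x \<le> y"
    from av_112_2121_decompose[OF this] obtain u v k where
      "w = u @ x # v @ replicate k x" "x \<notin> set u" "x \<notin> set v" by metis
    then show "\<exists>u v k. mset w = mset (u @ v) + replicate_mset (Suc k) x \<and> x \<notin> set u \<and> x \<notin> set v \<and>
        (k = m \<longrightarrow> w = ?ins u v)"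
      by (intro exI[of _ u] exI[of _ v] exI[of _ k]) simp
  next
    fix u v :: "'a list" assume "\<forall>y\<in>set u \<union> set v. x < y"
    then show "av_112_2121 (?ins u v) \<longleftrightarrow>
      av_112_2121 (u @ v) \<and> (m = 0 \<or> length u \<in> disjoint_cuts (u @ v))"
      by (simp add: av_112_2121_insert disjoint_cuts_def)
  qed (auto simp: disjoint_cuts_le[THEN subsetD, simplified] takeWhile_tail)
  also have "\<dots> = (\<Sum>w | w \<in> permutations_of_multiset M \<and> av_112_2121 w.
      insertion_sum m (size M) h (card (disjoint_cuts w)))"
  proof (rule sum.cong[OF refl])
    fix w assume "w \<in> {w. w \<in> permutations_of_multiset M \<and> av_112_2121 w}"
    then have w: "mset w = M" by (auto dest: permutations_of_multisetD)
    then have len: "length w = size M" by auto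
    have x: "x \<notin> set (take p w)" "x \<notin> set (drop p w)" for p
      using M w by (metis in_set_takeD order.irrefl set_mset_mset,
        metis in_set_dropD order.irrefl set_mset_mset)
    let ?D = "disjoint_cuts w"
    have D: "?D \<subseteq> {..size M}" using disjoint_cuts_le[of w] len by simp
    show "(\<Sum>p\<in>(if m = 0 then {..size M} else ?D). h (card (disjoint_cuts (?ins (take p w) (drop p w)))))
        = insertion_sum m (size M) h (card ?D)"
    proof (cases "m = 0")
      case True
      have "card (disjoint_cuts (?ins (take p w) (drop p w))) = card ?D + (if p \<in> ?D then 1 else 0)"
        if "p \<le> size M" for p
        using that True len disjoint_cuts_insert[OF x(1)[of p] x(2)[of p]] card_split_at[of ?D p] by simp
      with True show ?thesis by (simp flip: sum_card_plus_indicator[OF D])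
    next
      case False
      have "card (disjoint_cuts (?ins (take p w) (drop p w))) = Suc (card {q \<in> ?D. q \<le> p})"
        if "p \<in> ?D" for p
      proof -
        \<comment> \<open>Hence \<open>take p w\<close> has length \<open>p\<close>, and the added
          end exceeds every cut that is kept.\<close>
        have "p \<le> length w" using that D len by auto
        with False disjoint_cuts_insert_replicate[OF x(1)[of p] x(2)[of p], of m] show ?thesis
          by (simp add: card_insert_if)
      qed
      then show ?thesis
        using False sum_card_le[of ?D "h \<circ> Suc"] by (simp add: insertion_sum_def)
    qed
  qed
  finally show ?thesis .
qed

text \<open>For \<open>m > 0\<close>, inserting at the cut \<open>p\<close> keeps shifted copies of
  the cuts from \<open>p\<close> on and adds one before the last \<open>x\<close>. Ranks from the
  top thus lead to the same \<open>insertion_sum\<close>.\<close>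

lemma sum_av_121_1122:
  fixes x :: "'a::linorder"
  assumes M: "\<forall>y\<in>#M. x < y"
  shows "(\<Sum>w | w \<in> permutations_of_multiset (M + replicate_mset (Suc m) x) \<and> av_121_1122 w.
      h (card (distinct_cuts w))) =
    (\<Sum>w | w \<in> permutations_of_multiset M \<and> av_121_1122 w.
      insertion_sum m (size M) h (card (distinct_cuts w)))"
proof -
  let ?ins = "\<lambda>u v. u @ x # replicate m x @ v"
  have "(\<Sum>w | w \<in> permutations_of_multiset (M + replicate_mset (Suc m) x) \<and> av_121_1122 w.
      h (card (distinct_cuts w))) =
    (\<Sum>w | w \<in> permutations_of_multiset M \<and> av_121_1122 w.
       \<Sum>p\<in>(if m = 0 then {..size M} else distinct_cuts w).
         h (card (distinct_cuts (?ins (take p w) (drop p w)))))"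
  proof (rule sum_over_insertions[OF M])
    fix w :: "'a list" assume "av_121_1122 w" "x \<in> set w" "\<forall>y\<in>set w. x \<le> y"
    from av_121_1122_decompose[OF this] obtain u v k where
      "w = u @ x # replicate k x @ v" "x \<notin> set u" "x \<notin> set v" by metis
    then show "\<exists>u v k. mset w = mset (u @ v) + replicate_mset (Suc k) x \<and> x \<notin> set u \<and> x \<notin> set v \<and>
        (k = m \<longrightarrow> w = ?ins u v)"
      by (intro exI[of _ u] exI[of _ v] exI[of _ k]) simp
  next
    fix u v :: "'a list" assume "\<forall>y\<in>set u \<union> set v. x < y"
    then show "av_121_1122 (?ins u v) \<longleftrightarrow>
      av_121_1122 (u @ v) \<and> (m = 0 \<or> length u \<in> distinct_cuts (u @ v))"
      by (simp add: av_121_1122_insert distinct_cuts_def)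
  qed (auto simp: distinct_cuts_le[THEN subsetD, simplified] takeWhile_tail)
  also have "\<dots> = (\<Sum>w | w \<in> permutations_of_multiset M \<and> av_121_1122 w.
      insertion_sum m (size M) h (card (distinct_cuts w)))"
  proof (rule sum.cong[OF refl])
    fix w assume "w \<in> {w. w \<in> permutations_of_multiset M \<and> av_121_1122 w}"
    then have w: "mset w = M" by (auto dest: permutations_of_multisetD)
    then have len: "length w = size M" by auto
    have x: "x \<notin> set (take p w)" "x \<notin> set (drop p w)" for p
      using M w by (metis in_set_takeD order.irrefl set_mset_mset,
        metis in_set_dropD order.irrefl set_mset_mset)
    let ?D = "distinct_cuts w"
    have D: "?D \<subseteq> {..size M}" using distinct_cuts_le[of w] len by simp
    show "(\<Sum>p\<in>(if m = 0 then {..size M} else ?D). h (card (distinct_cuts (?ins (take p w) (drop p w)))))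
        = insertion_sum m (size M) h (card ?D)"
    proof (cases "m = 0")
      case True
      have "card (distinct_cuts (?ins (take p w) (drop p w))) = card ?D + (if p \<in> ?D then 1 else 0)"
        if "p \<le> size M" for p
        using that True len distinct_cuts_insert[OF x(1)[of p] x(2)[of p]] card_split_at[of ?D p] by simp
      with True show ?thesis by (simp flip: sum_card_plus_indicator[OF D])
    next
      case False
      have "card (distinct_cuts (?ins (take p w) (drop p w))) = Suc (card {q \<in> ?D. p \<le> q})"
        if "p \<in> ?D" for p
      proof -
        have p: "p \<le> length w" "distinct (drop p w)"
          using that by (auto simp: distinct_cuts_def)
        have "distinct_cuts (?ins (take p w) (drop p w)) =
            insert (p + m) ((\<lambda>q. Suc (q + m)) ` {q \<in> ?D. p \<le> q})"
          using distinct_cuts_insert_replicate[OF x(1)[of p] x(2)[of p] _ p(2), of m] False p(1) by simp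
        \<comment> \<open>The new cut lies strictly below all shifted ones.\<close>
        moreover have "p + m \<notin> (\<lambda>q. Suc (q + m)) ` {q \<in> ?D. p \<le> q}" by auto
        moreover have "inj_on (\<lambda>q. Suc (q + m)) {q \<in> ?D. p \<le> q}" by (auto simp: inj_on_def)
        ultimately show ?thesis by (simp add: card_image)
      qed
      then show ?thesis
        using False sum_card_ge[of ?D "h \<circ> Suc"] by (simp add: insertion_sum_def)
    qed
  qed
  finally show ?thesis .
qed

text \<open>
  Quantifying over all weights \<open>h\<close> expresses that the numbers of cuts are equidistributed.
\<close>

lemma cuts_equidistributed:
  fixes M :: "'a::linorder multiset" and h :: "nat \<Rightarrow> nat"
  shows "(\<Sum>w | w \<in> permutations_of_multiset M \<and> av_112_2121 w. h (card (disjoint_cuts w))) =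
    (\<Sum>w | w \<in> permutations_of_multiset M \<and> av_121_1122 w. h (card (distinct_cuts w)))"
proof (induction M arbitrary: h rule: measure_induct_rule[of size])
  case (less M)
  show ?case
  proof (cases "M = {#}")
    case True
    have "{w. w \<in> permutations_of_multiset M \<and> av_112_2121 w} = {[]}"
      "{w. w \<in> permutations_of_multiset M \<and> av_121_1122 w} = {[]}"
      unfolding True by (auto simp: av_112_2121_def av_121_1122_def)
    \<comment> \<open>Both trees start from the empty word, with the single cut 0.\<close>
    moreover have "disjoint_cuts ([] :: 'a list) = {0}" "distinct_cuts ([] :: 'a list) = {0}"
      by (auto simp: disjoint_cuts_def distinct_cuts_def)
    ultimately show ?thesis by simp
  next
    case False
    define x where "x = Min (set_mset M)"
    define N where "N = filter_mset (\<lambda>y. y \<noteq> x) M"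
    have "x \<in># M" using False by (simp add: x_def)
    then obtain m where m: "count M x = Suc m"
      by (metis count_greater_zero_iff gr0_implies_Suc)
    have M: "M = N + replicate_mset (Suc m) x"
      using multiset_partition[of M "\<lambda>y. y \<noteq> x"] by (simp only: N_def filter_eq_replicate_mset not_not m)
    have N: "\<forall>y\<in>#N. x < y"
      by (auto simp: N_def x_def order.strict_iff_order)
    have "size N < size M" by (simp add: M)
    \<comment> \<open>The hypothesis is used with the weight
      \<open>insertion_sum m (size N) h\<close>, which is why \<open>h\<close> is arbitrary in the
      induction.\<close>
    from less.IH[OF this] show ?thesis
      unfolding M sum_av_112_2121[OF N] sum_av_121_1122[OF N] .
  qed
qed

theorem theorem2p13:
  shows "m_equivalent {[1, 1, 2], [2, 1, 2, 1]} {[1, 2, 1], [1, 1, 2, 2]}"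
proof -
  have "(\<forall>\<rho>\<in>{[1, 1, 2], [2, 1, 2, 1]}. avoids_pattern \<pi> \<rho>) \<longleftrightarrow> av_112_2121 \<pi>"
    "(\<forall>\<rho>\<in>{[1, 2, 1], [1, 1, 2, 2]}. avoids_pattern \<pi> \<rho>) \<longleftrightarrow> av_121_1122 \<pi>" for \<pi>
    unfolding avoids_pattern_def av_112_2121_def av_121_1122_def
    using contains_pattern_112[of \<pi>] contains_pattern_2121[of \<pi>]
      contains_pattern_121[of \<pi>] contains_pattern_1122[of \<pi>] by auto
  \<comment> \<open>The constant weight 1 turns both sums into cardinalities.\<close>
  then show ?thesis
    unfolding m_equivalent_def av_def
    using cuts_equidistributed[where 'a = nat and h = "\<lambda>_. 1"] by simp
qed

end
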